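(* Let $X,Y$ be LCTV spaces, $\phi\colon X\times Y\to\overline{\mathbb R}$ a function, $F\colon X\rightrightarrows Y$ a set-valued mapping, and let $\mu(x):=\inf\{\phi(x,y)\mid y\in F(x)\}$ for $x\in X$. Put $$\mathcal V_p:=\inf\{\phi(0,y)\mid y\in F(0)\},\quad\mathcal V_d^1:=\sup_{x^*\in X^*}\{-\mu^*(x^* )\},\quad\mathcal V_d^2:=\sup_{x^*\in X^*}\{-(\phi^*\square F^* )(x^*,0)\}.$$ Then $$\mathcal V_p=\mu(0),\qquad\mathcal V_d^1=\mu^{**}(0),\qquad\mathcal V_d^2\le\mathcal V_d^1\le\mathcal V_p.$$ Moreover, if $\phi$ is an int-nearly convex function, $F$ is an int-nearly convex set-valued mapping, and $\operatorname{int}(\operatorname{epi}\phi)\cap\operatorname{int}\big((\operatorname{gph}F)\times\mathbb R\big)\neq\emptyset$, then $\mathcal V_d^1=\mathcal V_d^2$.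
   Context: LCTV space means real locally convex Hausdorff topological vector space; $X^*$ is the topological dual, $\langle x^*,x\rangle=x^*(x)$, and $(X\times Y)^*$ is identified with $X^*\times Y^*$. $\overline{\mathbb R}=\mathbb R\cup\{-\infty\}\cup\{\infty\}$, $\inf\emptyset=\infty$, $\sup\emptyset=-\infty$. $\operatorname{epi}f=\{(x,\lambda)\in X\times\mathbb R\mid f(x)\le\lambda\}$, $\operatorname{gph}F=\{(x,y)\mid y\in F(x)\}$. A set $\Omega$ is int-nearly convex if there is a convex set $C$ with $\operatorname{int}C\ne\emptyset$ and $C\subset\Omega\subset\overline C$; a function (resp. set-valued mapping) is int-nearly convex if its epigraph (resp. graph) is. The Fenchel conjugate of a function is $f^*(x^* )=\sup\{\langle x^*,x\rangle-f(x)\mid x\in X\}$, the biconjugate is $f^{**}(x)=\sup\{\langle x^*,x\rangle-f^*(x^* )\mid x^*\in X^*\}$, and the Fenchel conjugate of the set-valued mapping $F$ is $F^*(x^*,y^* )=\sup\{\langle x^*,x\rangle+\langle y^*,y\rangle\mid(x,y)\in\operatorname{gph}F\}$. $(\phi^*\square F^* )(x^*,0)=\inf\{\phi^*(x_1^*,y^* )+F^*(x_2^*,-y^* )\mid x_1^*+x_2^*=x^*,\ x_1^*,x_2^*\in X^*,\ y^*\in Y^*\}$. *)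

theory Defs
  imports "HOL-Analysis.Analysis"
begin

text \<open>
  Real locally convex Hausdorff topological vector spaces. In particular, the class contains
  every real normed space, but no norm or metric is required. The constants \<^const>\<open>convex\<close> and
  \<^const>\<open>continuous_on\<close> cannot be used in the class specification, so convexity and joint
  continuity of the scalar multiplication are written out; see the two lemmas below.
\<close>

class lctv_space = real_vector + topological_ab_group_add + t2_space +
  assumes tendsto_scaleR_Pair: "LIM x (nhds r \<times>\<^sub>F nhds a). fst x *\<^sub>R snd x :> nhds (r *\<^sub>R a)"
    and convex_local_base: "open U \<Longrightarrow> 0 \<in> U \<Longrightarrow> \<exists>V. open V \<and> 0 \<in> V \<and> V \<subseteq> U \<and>
      (\<forall>x\<in>V. \<forall>y\<in>V. \<forall>u\<ge>0. \<forall>v\<ge>0. u + v = 1 \<longrightarrow> u *\<^sub>R x + v *\<^sub>R y \<in> V)"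

lemma lctv_continuous_scaleR: "continuous_on UNIV (\<lambda>(r, x :: 'a::lctv_space). r *\<^sub>R x)"
  unfolding continuous_on_def
proof (intro ballI, goal_cases)
  case (1 p)
  have "((\<lambda>q. fst q *\<^sub>R snd q) \<longlongrightarrow> fst p *\<^sub>R snd p) (nhds p)"
    using tendsto_scaleR_Pair[of "fst p" "snd p"] by (simp add: nhds_prod[symmetric])
  then show ?case
    unfolding case_prod_unfold by (rule tendsto_mono[OF at_within_le_nhds])
qed

lemma lctv_convex_local_base:
  fixes U :: "'a::lctv_space set"
  assumes "open U" "0 \<in> U"
  shows "\<exists>V. open V \<and> convex V \<and> 0 \<in> V \<and> V \<subseteq> U"
  using convex_local_base[OF assms] unfolding convex_def by blast

instance real_normed_vector \<subseteq> lctv_space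
proof
  fix r :: real and a :: 'a
  show "LIM x (nhds r \<times>\<^sub>F nhds a). fst x *\<^sub>R snd x :> nhds (r *\<^sub>R a)"
    by (intro tendsto_scaleR filterlim_fst filterlim_snd)
next
  fix U :: "'a set"
  assume "open U" "0 \<in> U"
  then obtain e where e: "e > 0" "ball 0 e \<subseteq> U"
    by (meson open_contains_ball)
  then have "open (ball 0 e) \<and> 0 \<in> ball (0::'a) e \<and> ball 0 e \<subseteq> U \<and> convex (ball (0::'a) e)"
    by auto
  then show "\<exists>V. open V \<and> 0 \<in> V \<and> V \<subseteq> U \<and>
      (\<forall>x\<in>V. \<forall>y\<in>V. \<forall>u\<ge>0. \<forall>v\<ge>0. u + v = 1 \<longrightarrow> u *\<^sub>R x + v *\<^sub>R y \<in> V)"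
    unfolding convex_def by blast
qed

definition topdual :: "('a::lctv_space \<Rightarrow> real) set" where
  "topdual = {f. linear f \<and> continuous_on UNIV f}"

text \<open>
  The identification of $X^* \times Y^*$ with $(X \times Y)^*$.
\<close>

definition pair_functional :: "('a \<Rightarrow> real) \<Rightarrow> ('b \<Rightarrow> real) \<Rightarrow> 'a \<times> 'b \<Rightarrow> real" where
  "pair_functional xs ys = (\<lambda>(x, y). xs x + ys y)"

definition epi :: "('a \<Rightarrow> ereal) \<Rightarrow> ('a \<times> real) set" where
  "epi f = {(x, r). f x \<le> ereal r}"

definition gph :: "('a \<Rightarrow> 'b set) \<Rightarrow> ('a \<times> 'b) set" where
  "gph F = {(x, y). y \<in> F x}"

definition int_nearly_convex_set :: "'a::{real_vector, topological_space} set \<Rightarrow> bool" where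
  "int_nearly_convex_set A \<longleftrightarrow>
     (\<exists>C. convex C \<and> interior C \<noteq> {} \<and> C \<subseteq> A \<and> A \<subseteq> closure C)"

definition int_nearly_convex_fun :: "('a::{real_vector, topological_space} \<Rightarrow> ereal) \<Rightarrow> bool" where
  "int_nearly_convex_fun f \<longleftrightarrow> int_nearly_convex_set (epi f)"

definition int_nearly_convex_map ::
  "('a::{real_vector, topological_space} \<Rightarrow> 'b::{real_vector, topological_space} set) \<Rightarrow> bool" where
  "int_nearly_convex_map F \<longleftrightarrow> int_nearly_convex_set (gph F)"

text \<open>
  Conjugates are defined on arbitrary functionals; below they are only ever evaluated at
  elements of the topological dual.
\<close>

definition conjugate :: "('a \<Rightarrow> ereal) \<Rightarrow> ('a \<Rightarrow> real) \<Rightarrow> ereal" where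
  "conjugate f xs = (SUP x. ereal (xs x) - f x)"

definition biconjugate :: "('a::lctv_space \<Rightarrow> ereal) \<Rightarrow> 'a \<Rightarrow> ereal" where
  "biconjugate f x = (SUP xs\<in>topdual. ereal (xs x) - conjugate f xs)"

definition conjugate_map :: "('a \<Rightarrow> 'b set) \<Rightarrow> ('a \<Rightarrow> real) \<Rightarrow> ('b \<Rightarrow> real) \<Rightarrow> ereal" where
  "conjugate_map F xs ys = (SUP (x, y)\<in>gph F. ereal (xs x + ys y))"

text \<open>
  The value $(\phi^* \square F^*)(x^*, 0)$. Sums are taken in \<^typ>\<open>ereal\<close>, where
  \<^prop>\<open>\<infinity> + (- \<infinity>) = (\<infinity>::ereal)\<close>. A sum of this form can only occur here if
  $\phi$ is identically $\infty$ or the graph of $F$ is empty.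
\<close>

definition infconv_at_0 ::
  "('a::lctv_space \<times> 'b::lctv_space \<Rightarrow> ereal) \<Rightarrow> ('a \<Rightarrow> 'b set) \<Rightarrow> ('a \<Rightarrow> real) \<Rightarrow> ereal" where
  "infconv_at_0 \<phi> F xs =
     Inf {conjugate \<phi> (pair_functional x1 ys) + conjugate_map F x2 (\<lambda>y. - ys y) | x1 x2 ys.
            x1 \<in> topdual \<and> x2 \<in> topdual \<and> ys \<in> topdual \<and> (\<lambda>x. x1 x + x2 x) = xs}"

definition optimal_value :: "('a \<times> 'b \<Rightarrow> ereal) \<Rightarrow> ('a \<Rightarrow> 'b set) \<Rightarrow> 'a \<Rightarrow> ereal" where
  "optimal_value \<phi> F x = (INF y\<in>F x. \<phi> (x, y))"

definition primal_value :: "('a::zero \<times> 'b \<Rightarrow> ereal) \<Rightarrow> ('a \<Rightarrow> 'b set) \<Rightarrow> ereal" where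
  "primal_value \<phi> F = (INF y\<in>F 0. \<phi> (0, y))"

definition dual_value1 :: "('a::lctv_space \<times> 'b \<Rightarrow> ereal) \<Rightarrow> ('a \<Rightarrow> 'b set) \<Rightarrow> ereal" where
  "dual_value1 \<phi> F = (SUP xs\<in>topdual. - conjugate (optimal_value \<phi> F) xs)"

definition dual_value2 ::
  "('a::lctv_space \<times> 'b::lctv_space \<Rightarrow> ereal) \<Rightarrow> ('a \<Rightarrow> 'b set) \<Rightarrow> ereal" where
  "dual_value2 \<phi> F = (SUP xs\<in>topdual. - infconv_at_0 \<phi> F xs)"

end

theory Submission
  imports Defs
begin

text \<open>
  Only the last claim has substance. The conjugate \<open>\<mu>\<^sup>*(x\<^sup>*)\<close> is the supremum of
  \<open>x\<^sup>*(x) - \<phi>(x, y)\<close> over the graph of \<open>F\<close>, so splitting \<open>x\<^sup>* = x\<^sub>1\<^sup>* + x\<^sub>2\<^sup>*\<close> and inserting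
  \<open>y\<^sup>* - y\<^sup>*\<close> gives \<open>\<mu>\<^sup>*(x\<^sup>*) \<le> (\<phi>\<^sup>* \<box> F\<^sup>*)(x\<^sup>*, 0)\<close>, which is the inequality between the two dual
  values; the bound by the primal value is the Fenchel-Young inequality at \<open>0\<close>.

  For the reverse inequality (lemma \<open>infconv_le_conjugate_optimal_value\<close>) let
  \<open>m = \<mu>\<^sup>*(x\<^sup>*)\<close> be finite. Then \<open>x\<^sup>*(x) - m \<le> \<phi>(x, y)\<close> on the graph of \<open>F\<close>, so no point of the
  epigraph of \<open>\<phi>\<close> lies in the set of all \<open>(x, y, t)\<close> with \<open>y \<in> F(x)\<close> and \<open>t < x\<^sup>*(x) - m\<close>.
  Near convexity provides a convex set \<open>C\<close> with interior points, dense in the epigraph, and a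
  convex set \<open>G\<close>, dense in the graph; the part of the second set above \<open>G\<close> is
  convex and disjoint from \<open>C\<close>, so a closed hyperplane separates the two. By continuity the
  hyperplane bounds the full epigraph and the full graph. The qualification condition says that the
  hyperplane is not vertical: a functional of \<open>(x, y)\<close> alone would be constant on an open set
  and hence zero. A nonvertical hyperplane \<open>a(x) + b(y) + c t = \<gamma>\<close> with \<open>c > 0\<close> yields the
  dual variables \<open>x\<^sub>1\<^sup>* = - a / c\<close>, \<open>x\<^sub>2\<^sup>* = x\<^sup>* + a / c\<close>, \<open>y\<^sup>* = - b / c\<close>, at which the infimal
  convolution is at most \<open>m\<close>.

  The separation theorem (\<open>lctv_separation\<close>) rests on the Hahn-Banach theorem in
  the form that every sublinear functional dominates a linear one (\<open>linear_below_sublinear\<close>): by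
  Zorn's lemma there is a minimal sublinear functional below the given one, and minimal
  sublinear functionals are linear. To separate \<open>0\<close> from a convex set, this is applied to the
  order-unit functional of the cone that the set generates.
\<close>

section \<open>Minimal sublinear functionals\<close>

definition sublinear :: "('a::real_vector \<Rightarrow> real) \<Rightarrow> bool" where
  "sublinear p \<longleftrightarrow> (\<forall>x y. p (x + y) \<le> p x + p y) \<and> (\<forall>c>0. \<forall>x. p (c *\<^sub>R x) \<le> c * p x)"

lemma sublinear_add: "sublinear p \<Longrightarrow> p (x + y) \<le> p x + p y"
  by (simp add: sublinear_def)

lemma sublinear_scaleR_le: "sublinear p \<Longrightarrow> c > 0 \<Longrightarrow> p (c *\<^sub>R x) \<le> c * p x"
  by (simp add: sublinear_def)

lemma sublinear_scaleR:
  assumes p: "sublinear p" and "c \<ge> 0"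
  shows "p (c *\<^sub>R x) = c * p x"
proof (cases "c = 0")
  case True
  have "p 0 \<le> 2 * p 0" "p 0 \<le> (1/2) * p 0"
    using sublinear_scaleR_le[OF p, of 2 0] sublinear_scaleR_le[OF p, of "1/2" 0] by auto
  then show ?thesis using True by simp
next
  case False
  then have c: "c > 0" using \<open>c \<ge> 0\<close> by simp
  have "p x \<le> (1/c) * p (c *\<^sub>R x)"
    using sublinear_scaleR_le[OF p, of "1/c" "c *\<^sub>R x"] c by simp
  then have "c * p x \<le> p (c *\<^sub>R x)"
    using c by (simp add: field_simps)
  then show ?thesis using sublinear_scaleR_le[OF p c] by (simp add: antisym)
qed

lemma sublinear_neg_le: "sublinear p \<Longrightarrow> - p (- x) \<le> p x"
  using sublinear_add[of p x "- x"] sublinear_scaleR[of p 0 x] by simp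

text \<open>
  The lower bound \<open>b\<close> makes the pointwise infimum real. Subadditivity survives because, in a chain, the
  smaller of two functionals estimates both of them at once.
\<close>

lemma sublinear_Inf_chain:
  assumes C: "C \<noteq> {}" "\<And>q. q \<in> C \<Longrightarrow> sublinear q"
    and bdd: "\<And>q x. q \<in> C \<Longrightarrow> b x \<le> q x"
    and chain: "\<And>q r. q \<in> C \<Longrightarrow> r \<in> C \<Longrightarrow> q \<le> r \<or> r \<le> q"
  shows "sublinear (\<lambda>x. INF q\<in>C. q x)"
proof -
  let ?u = "\<lambda>x. INF q\<in>C. q x"
  have bb: "bdd_below ((\<lambda>q. q x) ` C)" for x
    using bdd by (auto intro!: bdd_belowI[of _ "b x"])
  have low: "?u x \<le> q x" if "q \<in> C" for q x
    using cINF_lower[OF bb that] .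
  have add: "?u (x + y) \<le> q x + r y" if qr: "q \<in> C" "r \<in> C" for q r x y
  proof -
    obtain s where s: "s \<in> C" "s \<le> q" "s \<le> r"
      using chain[OF qr] qr by auto
    have "?u (x + y) \<le> s (x + y)" using low[OF s(1)] .
    also have "\<dots> \<le> s x + s y" using sublinear_add C(2)[OF s(1)] by blast
    also have "\<dots> \<le> q x + r y" using s(2,3) by (intro add_mono) (auto simp: le_fun_def)
    finally show ?thesis .
  qed
  show ?thesis
    unfolding sublinear_def
  proof (intro conjI allI impI)
    fix x y
    have le: "?u (x + y) - q x \<le> ?u y" if "q \<in> C" for q
    proof (rule cINF_greatest[OF C(1)])
      show "?u (x + y) - q x \<le> r y" if "r \<in> C" for r
        using add[OF \<open>q \<in> C\<close> that, of x y] by linarith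
    qed
    have "?u (x + y) - ?u y \<le> ?u x"
    proof (intro cINF_greatest[OF C(1)])
      fix q assume "q \<in> C" then show "?u (x + y) - ?u y \<le> q x" using le[of q] by linarith
    qed
    then show "?u (x + y) \<le> ?u x + ?u y" by simp
  next
    fix c :: real and x assume c: "c > 0"
    have "?u (c *\<^sub>R x) / c \<le> q x" if "q \<in> C" for q
    proof -
      have "?u (c *\<^sub>R x) \<le> c * q x"
        using low[OF that, of "c *\<^sub>R x"] sublinear_scaleR_le[OF C(2)[OF that] c, of x] by linarith
      then show ?thesis using c by (simp add: field_simps)
    qed
    then have "?u (c *\<^sub>R x) / c \<le> ?u x"
      using C(1) by (intro cINF_greatest)
    then show "?u (c *\<^sub>R x) \<le> c * ?u x" using c by (simp add: field_simps)
  qed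
qed

text \<open>
  The functional \<open>q'\<close> lowers \<open>q\<close> as far as possible while making it affine in the direction \<open>y\<close>:
  the choice \<open>t = 0\<close> gives \<open>q' \<le> q\<close>, and \<open>t = 1\<close> at \<open>x = - y\<close> gives \<open>q' (- y) \<le> - q y\<close>.
\<close>

lemma sublinear_directional:
  fixes q :: "'a::real_vector \<Rightarrow> real" and y
  assumes q: "sublinear q"
  defines "q' \<equiv> \<lambda>x. INF t\<in>{0..}. q (x + t *\<^sub>R y) - t * q y"
  shows "sublinear q'" "t \<ge> 0 \<Longrightarrow> q' x \<le> q (x + t *\<^sub>R y) - t * q y"
proof -
  have "- q (- x) \<le> q (x + t *\<^sub>R y) - t * q y" if "t \<ge> 0" for t x
  proof -
    have "t * q y = q ((x + t *\<^sub>R y) + - x)"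
      using sublinear_scaleR[OF q that, of y] by simp
    also have "\<dots> \<le> q (x + t *\<^sub>R y) + q (- x)"
      by (rule sublinear_add[OF q])
    finally show ?thesis by simp
  qed
  then have bb: "bdd_below ((\<lambda>t. q (x + t *\<^sub>R y) - t * q y) ` {0..})" for x
    by (auto intro!: bdd_belowI[of _ "- q (- x)"])
  show low: "q' x \<le> q (x + t *\<^sub>R y) - t * q y" if "t \<ge> 0" for t x
    unfolding q'_def using cINF_lower[OF bb] that by simp
  have add: "q' (x + z) \<le> (q (x + s *\<^sub>R y) - s * q y) + (q (z + t *\<^sub>R y) - t * q y)"
    if "s \<ge> 0" "t \<ge> 0" for x z s t
    using low[of "s + t" "x + z"] sublinear_add[OF q, of "x + s *\<^sub>R y" "z + t *\<^sub>R y"] that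
    by (simp add: algebra_simps)
  have greatest: "m \<le> q' x" if "\<And>t. t \<ge> 0 \<Longrightarrow> m \<le> q (x + t *\<^sub>R y) - t * q y" for m x
    unfolding q'_def using that by (intro cINF_greatest) auto
  show "sublinear q'"
    unfolding sublinear_def
  proof (intro conjI allI impI)
    fix x z
    have le: "q' (x + z) - (q (x + s *\<^sub>R y) - s * q y) \<le> q' z" if "s \<ge> 0" for s
    proof (rule greatest)
      show "q' (x + z) - (q (x + s *\<^sub>R y) - s * q y) \<le> q (z + t *\<^sub>R y) - t * q y"
        if "t \<ge> 0" for t
        using add[OF \<open>s \<ge> 0\<close> that, of x z] by linarith
    qed
    have "q' (x + z) - q' z \<le> q' x"
    proof (rule greatest)
      show "q' (x + z) - q' z \<le> q (x + s *\<^sub>R y) - s * q y" if "s \<ge> 0" for s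
        using le[OF that] by linarith
    qed
    then show "q' (x + z) \<le> q' x + q' z" by simp
  next
    fix c :: real and x assume c: "c > 0"
    have "q' (c *\<^sub>R x) / c \<le> q' x"
    proof (rule greatest)
      fix t :: real assume t: "t \<ge> 0"
      have "q' (c *\<^sub>R x) \<le> q (c *\<^sub>R (x + t *\<^sub>R y)) - (c * t) * q y"
        using low[of "c * t" "c *\<^sub>R x"] c t by (simp add: algebra_simps)
      also have "\<dots> \<le> c * (q (x + t *\<^sub>R y) - t * q y)"
        using sublinear_scaleR_le[OF q c, of "x + t *\<^sub>R y"] by (simp add: algebra_simps)
      finally show "q' (c *\<^sub>R x) / c \<le> q (x + t *\<^sub>R y) - t * q y"
        using c by (simp add: field_simps)
    qed
    then show "q' (c *\<^sub>R x) \<le> c * q' x" using c by (simp add: field_simps)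
  qed
qed

text \<open>
  By minimality lowering \<open>q\<close> in the direction \<open>y\<close> does not change it, so
  \<open>q x \<le> q (x + y) - q y\<close>; this is the superadditivity that sublinear functionals lack.
\<close>

lemma linear_if_minimal_sublinear:
  assumes q: "sublinear q" and min: "\<And>r. sublinear r \<Longrightarrow> r \<le> q \<Longrightarrow> r = q"
  shows "linear q"
proof -
  have ge: "q x + q y \<le> q (x + y)" for x y
  proof -
    let ?q = "\<lambda>x. INF t\<in>{0..}. q (x + t *\<^sub>R y) - t * q y"
    have "?q \<le> q"
      using sublinear_directional(2)[OF q, of 0 _ y] by (auto simp: le_fun_def)
    then have "?q = q"
      using min sublinear_directional(1)[OF q] by blast
    then have "q x = ?q x" by (simp add: fun_eq_iff)
    also have "\<dots> \<le> q (x + 1 *\<^sub>R y) - 1 * q y"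
      by (rule sublinear_directional(2)[OF q]) simp
    finally show ?thesis by simp
  qed
  have add: "q (x + y) = q x + q y" for x y
    using ge sublinear_add[OF q] by (simp add: antisym)
  have q0: "q 0 = 0" using sublinear_scaleR[OF q, of 0 0] by simp
  have neg: "q (- x) = - q x" for x
    using add[of x "- x"] q0 by simp
  have "q (c *\<^sub>R x) = c * q x" for c x
  proof (cases "c \<ge> 0")
    case True then show ?thesis using sublinear_scaleR[OF q] by blast
  next
    case False
    then show ?thesis
      using sublinear_scaleR[OF q, of "- c" x] neg[of "c *\<^sub>R x"] by simp
  qed
  then show ?thesis using add by (intro linearI) auto
qed

theorem linear_below_sublinear:
  assumes p: "sublinear p"
  obtains f where "linear f" "\<And>x. f x \<le> p x"
proof -
  define A where "A = {q. sublinear q \<and> q \<le> p}"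
  have "\<exists>m\<in>A. \<forall>a\<in>A. m \<ge> a \<longrightarrow> a = m"
  proof (rule predicate_Zorn)
    show "partial_order_on A (relation_of (\<lambda>q r. q \<ge> r) A)"
      by (rule partial_order_on_relation_ofI) auto
  next
    fix C assume "C \<in> Chains (relation_of (\<lambda>q r. q \<ge> r) A)"
    then have CA: "C \<subseteq> A" and chain: "\<And>q r. q \<in> C \<Longrightarrow> r \<in> C \<Longrightarrow> q \<le> r \<or> r \<le> q"
      by (auto simp: Chains_def relation_of_def)
    show "\<exists>u\<in>A. \<forall>a\<in>C. a \<ge> u"
    proof (cases "C = {}")
      case True then show ?thesis using p by (auto simp: A_def)
    next
      case False
      let ?u = "\<lambda>x. INF q\<in>C. q x"
      have b: "- p (- x) \<le> q x" if "q \<in> C" for q x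
      proof -
        have "q \<le> p" "sublinear q" using that CA by (auto simp: A_def)
        then show ?thesis
          using sublinear_neg_le[of q x] le_funD[of q p "- x"] by linarith
      qed
      have sub: "sublinear ?u"
        using CA chain b False
        by (intro sublinear_Inf_chain[where b = "\<lambda>x. - p (- x)"]) (auto simp: A_def)
      have le: "?u \<le> q" if "q \<in> C" for q
        using that b by (auto simp: le_fun_def intro!: cINF_lower bdd_belowI[of _ "- p (- _)"])
      obtain q where "q \<in> C" using False by blast
      then have "?u \<le> p" using le[of q] CA by (auto simp: A_def intro: order_trans)
      then show ?thesis using sub le by (auto simp: A_def)
    qed
  qed
  then obtain m where m: "sublinear m" "m \<le> p" "\<And>a. sublinear a \<Longrightarrow> a \<le> p \<Longrightarrow> a \<le> m \<Longrightarrow> a = m"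
    by (auto simp: A_def)
  have "linear m"
    using m by (intro linear_if_minimal_sublinear) (auto intro: order_trans)
  then show ?thesis using that m(2) by (auto simp: le_fun_def)
qed

section \<open>Separation by a linear functional\<close>

text \<open>
  Let \<open>K\<close> be the convex cone generated by \<open>W\<close>. Since \<open>w0\<close> is an algebraically interior point of
  \<open>W\<close>, it is an order unit for \<open>K\<close>, and \<open>p x = inf {t. t w0 - x \<in> K}\<close> is a finite sublinear
  functional with \<open>p \<le> 0\<close> on \<open>- K\<close> and \<open>p (- w0) < 0\<close>. Any linear functional below \<open>p\<close> is
  therefore nonnegative on \<open>W\<close> and positive at \<open>w0\<close>.
\<close>

lemma linear_nonneg_on_convex:
  fixes W :: "'a::real_vector set"
  assumes W: "convex W" "0 \<notin> W" and w0: "w0 \<in> W"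
    and core: "\<And>v. \<exists>e>0. w0 + e *\<^sub>R v \<in> W"
  obtains f where "linear f" "\<And>w. w \<in> W \<Longrightarrow> f w \<ge> 0" "f w0 > (0::real)"
proof -
  define K where "K = {c *\<^sub>R w | c w. c > 0 \<and> w \<in> W}"
  have K_scale: "c *\<^sub>R k \<in> K" if k: "k \<in> K" and c: "c > 0" for c k
  proof -
    obtain d w where "k = d *\<^sub>R w" "d > 0" "w \<in> W" using k by (auto simp: K_def)
    then have "c *\<^sub>R k = (c * d) *\<^sub>R w \<and> c * d > 0 \<and> w \<in> W" using c by simp
    then show ?thesis unfolding K_def by blast
  qed
  have K_add: "k + l \<in> K" if "k \<in> K" "l \<in> K" for k l
  proof -
    obtain c w where k: "k = c *\<^sub>R w" "c > 0" "w \<in> W" using \<open>k \<in> K\<close> by (auto simp: K_def)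
    obtain d v where l: "l = d *\<^sub>R v" "d > 0" "v \<in> W" using \<open>l \<in> K\<close> by (auto simp: K_def)
    have "(c / (c + d)) *\<^sub>R w + (d / (c + d)) *\<^sub>R v \<in> W"
      using k l by (intro convexD[OF W(1)]) (auto simp flip: add_divide_distrib)
    moreover have "k + l = (c + d) *\<^sub>R ((c / (c + d)) *\<^sub>R w + (d / (c + d)) *\<^sub>R v)"
      using k l by (simp add: scaleR_right_distrib)
    moreover have "c + d > 0" using k l by simp
    ultimately show ?thesis unfolding K_def by blast
  qed
  have W_K: "w \<in> K" if "w \<in> W" for w
    using that unfolding K_def by (metis (mono_tags, lifting) mem_Collect_eq scaleR_one zero_less_one)
  have K0: "0 \<notin> K" using W(2) by (auto simp: K_def)
  have absorb: "\<exists>s. s *\<^sub>R w0 + x \<in> K" for x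
  proof -
    obtain e where e: "e > 0" "w0 + e *\<^sub>R x \<in> W" using core by blast
    have "(1/e) *\<^sub>R (w0 + e *\<^sub>R x) \<in> K" using e by (intro K_scale W_K) auto
    then show ?thesis using e by (auto simp: scaleR_right_distrib)
  qed
  define T where "T = (\<lambda>x. {t. t *\<^sub>R w0 - x \<in> K})"
  have T_ne: "T x \<noteq> {}" for x
    using absorb[of "- x"] by (auto simp: T_def)
  have T_bdd: "bdd_below (T x)" for x
  proof -
    obtain s where s: "s *\<^sub>R w0 + x \<in> K" using absorb by blast
    \<comment> \<open>Otherwise \<open>K\<close> contains both a negative and a positive multiple of \<open>w0\<close>, hence \<open>0\<close>.\<close>
    have "- s \<le> t" if "t \<in> T x" for t
    proof (rule ccontr)
      assume "\<not> - s \<le> t"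
      then have pos: "- (t + s) > 0" by simp
      have "(t *\<^sub>R w0 - x) + (s *\<^sub>R w0 + x) \<in> K" using K_add that s unfolding T_def by blast
      moreover have "(t *\<^sub>R w0 - x) + (s *\<^sub>R w0 + x) = (t + s) *\<^sub>R w0"
        by (simp add: algebra_simps)
      ultimately have "(t + s) *\<^sub>R w0 \<in> K" by simp
      moreover have "(- (t + s)) *\<^sub>R w0 \<in> K" using pos w0 by (intro K_scale W_K)
      ultimately have "(t + s) *\<^sub>R w0 + (- (t + s)) *\<^sub>R w0 \<in> K" by (rule K_add)
      then show False using K0 by (simp flip: scaleR_left_distrib)
    qed
    then show ?thesis by (rule bdd_belowI)
  qed
  define p where "p = (\<lambda>x. Inf (T x))"
  have p_le: "p x \<le> t" if "t \<in> T x" for x t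
    unfolding p_def using cInf_lower[OF that T_bdd] .
  have p_ge: "m \<le> p x" if "\<And>t. t \<in> T x \<Longrightarrow> m \<le> t" for x m
    unfolding p_def using cInf_greatest[OF T_ne] that by blast
  have "sublinear p"
    unfolding sublinear_def
  proof (intro conjI allI impI)
    fix x y
    have le1: "p (x + y) \<le> s + t" if "s \<in> T x" "t \<in> T y" for s t
      using K_add[of "s *\<^sub>R w0 - x" "t *\<^sub>R w0 - y"] that
      by (intro p_le) (simp add: T_def algebra_simps)
    have le2: "p (x + y) - s \<le> p y" if "s \<in> T x" for s
    proof (rule p_ge)
      show "p (x + y) - s \<le> t" if "t \<in> T y" for t
        using le1[OF \<open>s \<in> T x\<close> that] by linarith
    qed
    have "p (x + y) - p y \<le> p x"
    proof (rule p_ge)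
      show "p (x + y) - p y \<le> s" if "s \<in> T x" for s
        using le2[OF that] by linarith
    qed
    then show "p (x + y) \<le> p x + p y" by simp
  next
    fix c :: real and x assume c: "c > 0"
    have "p (c *\<^sub>R x) / c \<le> p x"
    proof (rule p_ge)
      fix t assume t: "t \<in> T x"
      have "p (c *\<^sub>R x) \<le> c * t"
        using K_scale[of "t *\<^sub>R w0 - x" c] t c
        by (intro p_le) (simp add: T_def algebra_simps)
      then show "p (c *\<^sub>R x) / c \<le> t" using c by (simp add: field_simps)
    qed
    then show "p (c *\<^sub>R x) \<le> c * p x" using c by (simp add: field_simps)
  qed
  then obtain f where f: "linear f" "\<And>x. f x \<le> p x"
    using linear_below_sublinear by blast
  have "f w \<ge> 0" if "w \<in> W" for w
  proof -
    have "p (- w) \<le> 0" using W_K[OF that] by (intro p_le) (simp add: T_def)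
    then show ?thesis using f(2)[of "- w"] linear_neg[OF f(1), of w] by simp
  qed
  moreover have "f w0 > 0"
  proof -
    have "(1/2) *\<^sub>R w0 \<in> K" using w0 by (intro K_scale W_K) auto
    moreover have "(- (1/2)) *\<^sub>R w0 - (- w0) = (1/2) *\<^sub>R w0"
      by (simp add: algebra_simps flip: scaleR_left_distrib)
    ultimately have "p (- w0) \<le> - (1/2)" by (intro p_le) (simp add: T_def)
    then show ?thesis using f(2)[of "- w0"] linear_neg[OF f(1), of w0] by simp
  qed
  ultimately show ?thesis using f(1) that by blast
qed

section \<open>Continuous linear functionals and products\<close>

lemma tendsto_scaleR_lctv:
  fixes g :: "'c \<Rightarrow> 'a::lctv_space"
  assumes "(f \<longlongrightarrow> r) G" "(g \<longlongrightarrow> a) G"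
  shows "((\<lambda>x. f x *\<^sub>R g x) \<longlongrightarrow> r *\<^sub>R a) G"
  using filterlim_compose[OF tendsto_scaleR_Pair filterlim_Pair[OF assms]] by simp

text \<open>
  Epigraphs live in \<open>(X \<times> Y) \<times> \<real>\<close>; the following instances make the separation theorem
  applicable there.
\<close>

instance prod :: (topological_monoid_add, topological_monoid_add) topological_monoid_add
proof
  fix a b :: "'a \<times> 'b"
  show "LIM x (nhds a \<times>\<^sub>F nhds b). fst x + snd x :> nhds (a + b)"
    unfolding plus_prod_def
    by (intro tendsto_Pair tendsto_add tendsto_fst tendsto_snd filterlim_fst filterlim_snd)
qed

instance prod :: (topological_group_add, topological_group_add) topological_group_add
proof
  fix a :: "'a \<times> 'b"
  show "(uminus \<longlongrightarrow> - a) (nhds a)"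
    unfolding uminus_prod_def
    by (intro tendsto_Pair tendsto_minus tendsto_fst tendsto_snd filterlim_ident)
qed

instance prod :: (topological_ab_group_add, topological_ab_group_add) topological_ab_group_add ..

instance prod :: (lctv_space, lctv_space) lctv_space
proof
  fix r :: real and a :: "'a \<times> 'b"
  show "LIM x (nhds r \<times>\<^sub>F nhds a). fst x *\<^sub>R snd x :> nhds (r *\<^sub>R a)"
    unfolding scaleR_prod_def
    by (intro tendsto_Pair tendsto_scaleR_lctv tendsto_fst tendsto_snd filterlim_fst filterlim_snd)
next
  fix U :: "('a \<times> 'b) set"
  assume "open U" "0 \<in> U"
  then obtain A B where AB: "open A" "open B" "0 \<in> A \<times> B" "A \<times> B \<subseteq> U"
    by (rule open_prod_elim)
  obtain A' where A': "open A'" "convex A'" "0 \<in> A'" "A' \<subseteq> A"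
    using lctv_convex_local_base[OF AB(1)] AB(3) by (auto simp: zero_prod_def)
  obtain B' where B': "open B'" "convex B'" "0 \<in> B'" "B' \<subseteq> B"
    using lctv_convex_local_base[OF AB(2)] AB(3) by (auto simp: zero_prod_def)
  have "open (A' \<times> B')" "0 \<in> A' \<times> B'" "A' \<times> B' \<subseteq> U" "convex (A' \<times> B')"
    using A' B' AB(4) by (auto simp: zero_prod_def open_Times convex_Times)
  then show "\<exists>V. open V \<and> 0 \<in> V \<and> V \<subseteq> U \<and>
      (\<forall>x\<in>V. \<forall>y\<in>V. \<forall>u\<ge>0. \<forall>v\<ge>0. u + v = 1 \<longrightarrow> u *\<^sub>R x + v *\<^sub>R y \<in> V)"
    unfolding convex_def by (intro exI[of _ "A' \<times> B'"] conjI)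
qed

lemma open_absorbs:
  fixes U :: "'a::lctv_space set"
  assumes "open U" "u \<in> U"
  shows "\<exists>e>0. u + e *\<^sub>R v \<in> U"
proof -
  have "((\<lambda>e. u + e *\<^sub>R v) \<longlongrightarrow> u + 0 *\<^sub>R v) (at_right 0)"
    by (intro tendsto_add tendsto_scaleR_lctv tendsto_const tendsto_ident_at)
  then have "\<forall>\<^sub>F e in at_right 0. u + e *\<^sub>R v \<in> U"
    using assms by (intro topological_tendstoD) auto
  moreover have "\<forall>\<^sub>F e in at_right 0. e > (0::real)"
    by (rule eventually_at_right_less)
  ultimately have "\<forall>\<^sub>F e in at_right 0. e > 0 \<and> u + e *\<^sub>R v \<in> U"
    by eventually_elim auto
  then show ?thesis
    using eventually_happens'[of "at_right (0::real)"] by fastforce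
qed

text \<open>
  Near \<open>0\<close> both \<open>u + v\<close> and \<open>u - v\<close> lie in \<open>U\<close>, so \<open>\<bar>f v\<bar> \<le> f u\<close> there: \<open>f\<close> is bounded on
  a neighbourhood of \<open>0\<close>, and continuity follows by scaling that neighbourhood.
\<close>

lemma linear_nonneg_imp_continuous:
  fixes f :: "'a::lctv_space \<Rightarrow> real"
  assumes f: "linear f" and U: "open U" "u \<in> U" and nonneg: "\<And>x. x \<in> U \<Longrightarrow> f x \<ge> 0"
  shows "continuous_on UNIV f"
  unfolding continuous_on_def
proof (intro ballI tendstoI)
  fix a :: 'a and e :: real assume e: "e > 0"
  \<comment> \<open>Adding \<open>1\<close> makes the scaling factor positive and the final estimate strict.\<close>
  define c where "c = (f u + 1) / e"
  have c: "c > 0" using nonneg[OF U(2)] e by (simp add: c_def)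
  have lim: "((\<lambda>x. u + d *\<^sub>R (x - a)) \<longlongrightarrow> u) (at a)" for d
  proof -
    have "((\<lambda>x. u + d *\<^sub>R (x + - a)) \<longlongrightarrow> u + d *\<^sub>R (a + - a)) (at a)"
      by (intro tendsto_add tendsto_scaleR_lctv tendsto_const tendsto_ident_at)
    then show ?thesis by simp
  qed
  have "\<forall>\<^sub>F x in at a. u + c *\<^sub>R (x - a) \<in> U" "\<forall>\<^sub>F x in at a. u + (- c) *\<^sub>R (x - a) \<in> U"
    using topological_tendstoD[OF lim U] by blast+
  then show "\<forall>\<^sub>F x in at a. dist (f x) (f a) < e"
  proof eventually_elim
    case (elim x)
    have eq: "f (u + d *\<^sub>R (x - a)) = f u + d * (f x - f a)" for d
      by (simp add: linear_add[OF f] linear_diff[OF f] linear_scale[OF f])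
    have "f u + c * (f x - f a) \<ge> 0" "f u + (- c) * (f x - f a) \<ge> 0"
      using nonneg[OF elim(1)] nonneg[OF elim(2)] unfolding eq .
    then have "c * \<bar>f x - f a\<bar> \<le> f u"
      using c by (cases "f x \<ge> f a") (simp_all add: algebra_simps)
    also have "f u < c * e" using e by (simp add: c_def)
    finally show ?case using c by (simp add: dist_real_def)
  qed
qed

lemma linear_const_on_open:
  fixes f :: "'a::lctv_space \<Rightarrow> real"
  assumes f: "linear f" and U: "open U" "u \<in> U" and const: "\<And>x. x \<in> U \<Longrightarrow> f x = \<gamma>"
  shows "f v = 0"
proof -
  obtain e where "e > 0" "u + e *\<^sub>R v \<in> U" using open_absorbs[OF U] by blast
  then show ?thesis
    using const[OF U(2)] const[of "u + e *\<^sub>R v"] by (simp add: linear_add[OF f] linear_scale[OF f])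
qed

text \<open>
  The difference set of \<open>C\<close> and \<open>D\<close> is convex, misses \<open>0\<close>, and is absorbing around
  \<open>c0 - d0\<close> for every interior point \<open>c0\<close> of \<open>C\<close>, so some nonzero linear functional is
  nonnegative on it. It is continuous because it is bounded below on the interior of \<open>C\<close>.
\<close>

theorem lctv_separation:
  fixes C D :: "'a::lctv_space set"
  assumes C: "convex C" "interior C \<noteq> {}" and D: "convex D" "D \<noteq> {}" and disj: "C \<inter> D = {}"
  obtains f \<gamma> where "f \<in> topdual" "\<And>x. x \<in> C \<Longrightarrow> \<gamma> \<le> f x" "\<And>x. x \<in> D \<Longrightarrow> f x \<le> \<gamma>"
    "\<exists>x. f x \<noteq> 0"
proof -
  obtain c0 where c0: "c0 \<in> interior C" using C(2) by blast
  then have c0C: "c0 \<in> C" using interior_subset by blast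
  obtain d0 where d0: "d0 \<in> D" using D(2) by blast
  define W where "W = {x - y | x y. x \<in> C \<and> y \<in> D}"
  have "W = (\<Union>x\<in>C. \<Union>y\<in>D. {x - y})" by (auto simp: W_def)
  then have "convex W" using convex_differences[OF C(1) D(1)] by simp
  moreover have "0 \<notin> W" using disj by (auto simp: W_def)
  moreover have "c0 - d0 \<in> W" using c0C d0 by (auto simp: W_def)
  moreover have "\<exists>e>0. (c0 - d0) + e *\<^sub>R v \<in> W" for v
  proof -
    obtain e where e: "e > 0" "c0 + e *\<^sub>R v \<in> interior C"
      using open_absorbs[OF open_interior c0] by blast
    then have "c0 + e *\<^sub>R v \<in> C" using interior_subset by blast
    moreover have "(c0 - d0) + e *\<^sub>R v = (c0 + e *\<^sub>R v) - d0" by simp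
    ultimately show ?thesis using d0 e(1) unfolding W_def by blast
  qed
  ultimately obtain f where f: "linear f" "\<And>w. w \<in> W \<Longrightarrow> f w \<ge> 0" "f (c0 - d0) > (0::real)"
    using linear_nonneg_on_convex[of W "c0 - d0"] by blast
  have le: "f y \<le> f x" if "x \<in> C" "y \<in> D" for x y
  proof -
    have "x - y \<in> W" using that by (auto simp: W_def)
    then show ?thesis using f(2)[of "x - y"] by (simp add: linear_diff[OF f(1)])
  qed
  have "continuous_on UNIV f"
  proof (rule linear_nonneg_imp_continuous[OF f(1)])
    have cont: "continuous_on UNIV (\<lambda>x. x + d0)"
      unfolding continuous_on_def by (intro ballI tendsto_add tendsto_const tendsto_ident_at)
    show "open ((\<lambda>x. x + d0) -` interior C)"
      using open_vimage[OF open_interior cont] .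
    show "c0 - d0 \<in> (\<lambda>x. x + d0) -` interior C" using c0 by simp
    show "f x \<ge> 0" if "x \<in> (\<lambda>x. x + d0) -` interior C" for x
    proof -
      have "x + d0 \<in> C" using that interior_subset by auto
      then show ?thesis using le[of "x + d0" d0] d0 by (simp add: linear_add[OF f(1)])
    qed
  qed
  then have "f \<in> topdual" using f(1) by (simp add: topdual_def)
  moreover have "(INF x\<in>C. f x) \<le> f x" if "x \<in> C" for x
    using le[OF _ d0] that by (intro cINF_lower bdd_belowI[of _ "f d0"]) auto
  moreover have "f y \<le> (INF x\<in>C. f x)" if "y \<in> D" for y
    using le that c0C by (intro cINF_greatest) auto
  moreover have "\<exists>x. f x \<noteq> 0" using f(3) by (metis less_irrefl)
  ultimately show ?thesis using that by blast
qed

lemma topdual_compose: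
  assumes "f \<in> topdual" "linear g" "continuous_on UNIV g"
  shows "(\<lambda>x. f (g x)) \<in> topdual"
proof -
  have "linear (\<lambda>x. f (g x))"
    using linear_compose[OF assms(2), of f] assms(1) by (simp add: topdual_def o_def)
  moreover have "continuous_on UNIV (\<lambda>x. f (g x))"
    using assms(1) by (intro continuous_on_compose2[OF _ assms(3) subset_UNIV]) (simp add: topdual_def)
  ultimately show ?thesis by (simp add: topdual_def)
qed

lemma topdual_fst: "f \<in> topdual \<Longrightarrow> (\<lambda>z. f (fst z)) \<in> topdual"
  by (rule topdual_compose[OF _ linear_fst continuous_on_fst[OF continuous_on_id]])

lemma topdual_snd: "f \<in> topdual \<Longrightarrow> (\<lambda>z. f (snd z)) \<in> topdual"
  by (rule topdual_compose[OF _ linear_snd continuous_on_snd[OF continuous_on_id]])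

lemma topdual_add: "f \<in> topdual \<Longrightarrow> g \<in> topdual \<Longrightarrow> (\<lambda>x. f x + g x) \<in> topdual"
  by (simp add: topdual_def linear_compose_add continuous_on_add)

lemma topdual_cmult: "f \<in> topdual \<Longrightarrow> (\<lambda>x. c * f x) \<in> topdual"
  using linear_compose_scale_right[of f c]
  by (simp add: topdual_def continuous_on_mult continuous_on_const)

section \<open>Duality\<close>

text \<open>
  This turns bounds on a conjugate into affine minorants. It holds for all extended \<open>u\<close> and \<open>m\<close>
  because \<open>a\<close> is finite, so that no difference of two infinities of equal sign has to be taken.
\<close>

lemma ereal_minus_le_swap: "ereal a - u \<le> m \<longleftrightarrow> ereal a - m \<le> u"
  by (cases u; cases m) auto

lemma conjugate_optimal_value_le_iff:
  "conjugate (optimal_value \<phi> F) xs \<le> m \<longleftrightarrow> (\<forall>(x, y)\<in>gph F. ereal (xs x) - \<phi> (x, y) \<le> m)"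
  by (auto simp: conjugate_def optimal_value_def gph_def SUP_le_iff ereal_minus_le_swap[of _ _ m]
      le_INF_iff)

lemma conjugate_optimal_value_le_infconv:
  "conjugate (optimal_value \<phi> F) xs \<le> infconv_at_0 \<phi> F xs"
  unfolding infconv_at_0_def conjugate_optimal_value_le_iff
proof (intro ballI, safe, intro Inf_greatest, safe)
  fix x y x1 x2 ys
  assume xy: "(x, y) \<in> gph F"
  have "ereal (x1 x + x2 x) - \<phi> (x, y)
      = (ereal (x1 x + ys y) - \<phi> (x, y)) + ereal (x2 x + - ys y)"
    by (cases "\<phi> (x, y)") auto
  also have "\<dots> \<le> conjugate \<phi> (pair_functional x1 ys) + conjugate_map F x2 (\<lambda>y. - ys y)"
  proof (rule add_mono)
    show "ereal (x1 x + ys y) - \<phi> (x, y) \<le> conjugate \<phi> (pair_functional x1 ys)"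
      unfolding conjugate_def by (rule SUP_upper2[of "(x, y)"]) (auto simp: pair_functional_def)
    show "ereal (x2 x + - ys y) \<le> conjugate_map F x2 (\<lambda>y. - ys y)"
      unfolding conjugate_map_def by (rule SUP_upper2[OF xy]) auto
  qed
  finally show "ereal (x1 x + x2 x) - \<phi> (x, y)
      \<le> conjugate \<phi> (pair_functional x1 ys) + conjugate_map F x2 (\<lambda>y. - ys y)" .
qed

text \<open>
  This is where convexity and the qualification condition enter. The infimum is even attained when the
  right-hand side is finite: the separating hyperplane gives an explicit minimizer.
\<close>

lemma infconv_le_conjugate_optimal_value:
  fixes \<phi> :: "'a::lctv_space \<times> 'b::lctv_space \<Rightarrow> ereal" and F :: "'a \<Rightarrow> 'b set"
  assumes \<phi>: "int_nearly_convex_fun \<phi>" and F: "int_nearly_convex_map F"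
    and qual: "interior (epi \<phi>) \<inter> interior (gph F \<times> (UNIV :: real set)) \<noteq> {}"
    and xs: "xs \<in> topdual"
  shows "infconv_at_0 \<phi> F xs \<le> conjugate (optimal_value \<phi> F) xs"
proof (cases "conjugate (optimal_value \<phi> F) xs = \<infinity>")
  case True
  then show ?thesis by simp
next
  case False
  let ?U = "interior (epi \<phi>) \<inter> interior (gph F \<times> (UNIV :: real set))"
  obtain x0 y0 t0 where p0: "((x0, y0), t0) \<in> ?U" using qual by fastforce
  then have epi0: "((x0, y0), t0) \<in> epi \<phi>" and gph0: "(x0, y0) \<in> gph F"
    using interior_subset by blast+
  \<comment> \<open>A common point of the graph and the domain excludes the value \<open>- \<infinity>\<close>.\<close>
  have "ereal (xs x0) - \<phi> (x0, y0) \<le> conjugate (optimal_value \<phi> F) xs"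
    using gph0 conjugate_optimal_value_le_iff[of \<phi> F xs "conjugate (optimal_value \<phi> F) xs"] by auto
  moreover have "\<phi> (x0, y0) \<le> ereal t0" using epi0 by (simp add: epi_def)
  ultimately have "conjugate (optimal_value \<phi> F) xs \<noteq> - \<infinity>"
    by (cases "\<phi> (x0, y0)") auto
  then obtain m where m: "conjugate (optimal_value \<phi> F) xs = ereal m"
    using False by (cases "conjugate (optimal_value \<phi> F) xs") auto
  have bound: "ereal (xs x - m) \<le> \<phi> (x, y)" if "(x, y) \<in> gph F" for x y
    using that conjugate_optimal_value_le_iff[of \<phi> F xs "ereal m"] m
    by (auto simp: ereal_minus_le_swap[of _ _ "ereal m"])

  obtain C where C: "convex C" "interior C \<noteq> {}" "C \<subseteq> epi \<phi>" "epi \<phi> \<subseteq> closure C"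
    using \<phi> by (auto simp: int_nearly_convex_fun_def int_nearly_convex_set_def)
  obtain G where G: "convex G" "interior G \<noteq> {}" "G \<subseteq> gph F" "gph F \<subseteq> closure G"
    using F by (auto simp: int_nearly_convex_map_def int_nearly_convex_set_def)
  have xs_lin: "linear xs"
    using xs by (auto simp: topdual_def)
  \<comment> \<open>The strict inequality keeps \<open>D\<close> disjoint from all of \<open>C\<close>, boundary points included.\<close>
  define D where "D = {((x, y), t) | x y t. (x, y) \<in> G \<and> t < xs x - m}"
  have "D = (G \<times> UNIV) \<inter> (\<lambda>p. snd p - xs (fst (fst p))) -` {..< - m}"
    by (auto simp: D_def)
  moreover have "linear (\<lambda>p :: ('a \<times> 'b) \<times> real. snd p - xs (fst (fst p)))"
    by (rule linearI) (simp_all add: linear_add[OF xs_lin] linear_scale[OF xs_lin] algebra_simps)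
  ultimately have "convex D"
    using G(1) by (auto intro!: convex_Int convex_Times convex_linear_vimage)
  moreover have "D \<noteq> {}"
  proof -
    obtain x y where "(x, y) \<in> G" using G(2) interior_subset by fastforce
    then have "((x, y), xs x - m - 1) \<in> D" by (simp add: D_def)
    then show ?thesis by blast
  qed
  moreover have "C \<inter> D = {}"
  proof -
    have False if "((x, y), t) \<in> C" "(x, y) \<in> G" "t < xs x - m" for x y t
    proof -
      have "ereal (xs x - m) \<le> \<phi> (x, y)" using bound that(2) G(3) by blast
      also have "\<phi> (x, y) \<le> ereal t" using that(1) C(3) by (auto simp: epi_def)
      finally show False using that(3) by simp
    qed
    then show ?thesis by (auto simp: D_def)
  qed
  ultimately obtain f \<gamma> where f: "f \<in> topdual" and fC: "\<And>p. p \<in> C \<Longrightarrow> \<gamma> \<le> f p"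
    and fD: "\<And>p. p \<in> D \<Longrightarrow> f p \<le> \<gamma>" and f0: "\<exists>p. f p \<noteq> 0"
    using lctv_separation[OF C(1,2)] by blast
  have f_lin: "linear f" and f_cont: "continuous_on UNIV f"
    using f by (auto simp: topdual_def)

  define a where "a = (\<lambda>x. f ((x, 0), 0))"
  define b where "b = (\<lambda>y. f ((0, y), 0))"
  define c where "c = f ((0, 0), 1)"
  have f_eq: "f ((x, y), t) = a x + b y + c * t" for x y t
  proof -
    have "((x, y), t) = ((x, 0), 0) + ((0, y), 0) + t *\<^sub>R ((0, 0), 1)" by simp
    then show ?thesis
      unfolding a_def b_def c_def
      by (metis linear_add[OF f_lin] linear_scale[OF f_lin] mult.commute real_scaleR_def)
  qed
  have a_dual: "a \<in> topdual" unfolding a_def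
    by (rule topdual_compose[OF f]) (intro linearI continuous_intros; simp)+
  have b_dual: "b \<in> topdual" unfolding b_def
    by (rule topdual_compose[OF f]) (intro linearI continuous_intros; simp)+

  have f_epi: "\<gamma> \<le> a x + b y + c * t" if "((x, y), t) \<in> epi \<phi>" for x y t
  proof -
    have "closed {p. \<gamma> \<le> f p}"
      by (intro closed_Collect_le continuous_on_const f_cont)
    then have "closure C \<subseteq> {p. \<gamma> \<le> f p}"
      using fC by (intro closure_minimal) auto
    then show ?thesis using that C(4) f_eq by auto
  qed
  \<comment> \<open>Epigraphs are unbounded upwards, which rules out a negative slope.\<close>
  have c_nonneg: "c \<ge> 0"
  proof (rule ccontr)
    assume "\<not> c \<ge> 0"
    then have c: "c < 0" by simp
    define s where "s = max 0 ((a x0 + b y0 + c * t0 - \<gamma>) / (- c) + 1)"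
    have "\<phi> (x0, y0) \<le> ereal (t0 + s)"
      using epi0 by (auto simp: epi_def s_def intro: order_trans)
    then have "\<gamma> \<le> a x0 + b y0 + c * (t0 + s)" by (intro f_epi) (simp add: epi_def)
    moreover have "c * s \<le> c * ((a x0 + b y0 + c * t0 - \<gamma>) / (- c) + 1)"
      using c by (intro mult_left_mono_neg) (auto simp: s_def)
    moreover have "c * ((a x0 + b y0 + c * t0 - \<gamma>) / (- c) + 1)
        = - (a x0 + b y0 + c * t0 - \<gamma>) + c"
      using c by (simp add: field_simps)
    moreover have "c * (t0 + s) = c * t0 + c * s" by (rule distrib_left)
    ultimately show False using c by linarith
  qed
  have f_gph: "a x + b y + c * (xs x - m) \<le> \<gamma>" if "(x, y) \<in> gph F" for x y
  proof -
    have G_le: "a x + b y + c * (xs x - m) \<le> \<gamma>" if xy: "(x, y) \<in> G" for x y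
    proof (rule field_le_epsilon)
      fix e :: real assume e: "e > 0"
      \<comment> \<open>The denominator \<open>c + 1\<close> is positive even if \<open>c = 0\<close>, which is excluded only below.\<close>
      define t where "t = xs x - m - e / (c + 1)"
      have "t < xs x - m" using e c_nonneg by (simp add: t_def)
      then have "a x + b y + c * t \<le> \<gamma>"
        using fD[of "((x, y), t)"] xy f_eq by (auto simp: D_def)
      moreover have "c * t = c * (xs x - m) - c * (e / (c + 1))"
        by (simp add: t_def algebra_simps)
      moreover have "c * (e / (c + 1)) \<le> e" using e c_nonneg by (simp add: field_simps)
      ultimately show "a x + b y + c * (xs x - m) \<le> \<gamma> + e" by linarith
    qed
    have "(\<lambda>z :: 'a \<times> 'b. a (fst z)) \<in> topdual" "(\<lambda>z :: 'a \<times> 'b. b (snd z)) \<in> topdual"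
      "(\<lambda>z :: 'a \<times> 'b. xs (fst z)) \<in> topdual"
      by (rule topdual_fst[OF a_dual] topdual_snd[OF b_dual] topdual_fst[OF xs])+
    then have cont: "continuous_on UNIV (\<lambda>z :: 'a \<times> 'b. a (fst z))"
      "continuous_on UNIV (\<lambda>z :: 'a \<times> 'b. b (snd z))"
      "continuous_on UNIV (\<lambda>z :: 'a \<times> 'b. xs (fst z))"
      by (simp_all add: topdual_def)
    have "closed {z. a (fst z) + b (snd z) + c * (xs (fst z) - m) \<le> \<gamma>}"
      by (intro closed_Collect_le continuous_on_add continuous_on_mult continuous_on_diff
          continuous_on_const cont)
    then have "closure G \<subseteq> {z. a (fst z) + b (snd z) + c * (xs (fst z) - m) \<le> \<gamma>}"
      using G_le by (intro closure_minimal) auto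
    then show ?thesis using that G(4) by auto
  qed
  \<comment> \<open>For a vertical hyperplane the two estimates meet: \<open>f\<close> would be \<open>\<gamma>\<close> on the open set \<open>?U\<close>.\<close>
  have "c \<noteq> 0"
  proof
    assume c: "c = 0"
    have "f p = \<gamma>" if "p \<in> ?U" for p
    proof -
      obtain x y t where p: "p = ((x, y), t)" by (metis surj_pair)
      have "((x, y), t) \<in> epi \<phi>" "(x, y) \<in> gph F" using that p interior_subset by blast+
      then show ?thesis using f_epi[of x y t] f_gph[of x y] c p f_eq by auto
    qed
    then have "f p = 0" for p
      using linear_const_on_open[OF f_lin _ p0] by blast
    then show False using f0 by blast
  qed
  then have c: "c > 0" using c_nonneg by simp

  define x1 where "x1 = (\<lambda>x. (- (1/c)) * a x)"
  define x2 where "x2 = (\<lambda>x. xs x + (1/c) * a x)"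
  define ys where "ys = (\<lambda>y. (- (1/c)) * b y)"
  have "x1 \<in> topdual" "x2 \<in> topdual" "ys \<in> topdual"
    unfolding x1_def x2_def ys_def
    by (intro topdual_add topdual_cmult a_dual b_dual xs)+
  moreover have "(\<lambda>x. x1 x + x2 x) = xs" by (simp add: x1_def x2_def)
  ultimately have "infconv_at_0 \<phi> F xs
      \<le> conjugate \<phi> (pair_functional x1 ys) + conjugate_map F x2 (\<lambda>y. - ys y)"
    unfolding infconv_at_0_def by (intro Inf_lower) blast
  also have "\<dots> \<le> ereal (- \<gamma> / c) + ereal (\<gamma> / c + m)"
  proof (rule add_mono)
    have "ereal (x1 x + ys y) - ereal (- \<gamma> / c) \<le> \<phi> (x, y)" for x y
    proof (rule ereal_le_real)
      fix t assume "\<phi> (x, y) \<le> ereal t"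
      then have "\<gamma> \<le> a x + b y + c * t" by (intro f_epi) (simp add: epi_def)
      then show "ereal (x1 x + ys y) - ereal (- \<gamma> / c) \<le> ereal t"
        using c by (simp add: x1_def ys_def field_simps)
    qed
    then show "conjugate \<phi> (pair_functional x1 ys) \<le> ereal (- \<gamma> / c)"
      by (auto simp: conjugate_def pair_functional_def ereal_minus_le_swap[of _ "\<phi> _"]
          intro!: SUP_least)
    show "conjugate_map F x2 (\<lambda>y. - ys y) \<le> ereal (\<gamma> / c + m)"
      unfolding conjugate_map_def
    proof (rule SUP_least, safe)
      fix x y assume "(x, y) \<in> gph F"
      then have "(a x + b y + c * (xs x - m)) / c \<le> \<gamma> / c"
        using c by (intro divide_right_mono f_gph) simp_all
      moreover have "x2 x + - ys y = (a x + b y + c * (xs x - m)) / c + m"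
        using c by (simp add: x2_def ys_def add_divide_distrib)
      ultimately show "ereal (x2 x + - ys y) \<le> ereal (\<gamma> / c + m)" by simp
    qed
  qed
  also have "\<dots> = conjugate (optimal_value \<phi> F) xs" using m by simp
  finally show ?thesis .
qed

theorem proposition7p1:
  fixes \<phi> :: "'a::lctv_space \<times> 'b::lctv_space \<Rightarrow> ereal"
    and F :: "'a \<Rightarrow> 'b set"
  shows "primal_value \<phi> F = optimal_value \<phi> F 0
    \<and> dual_value1 \<phi> F = biconjugate (optimal_value \<phi> F) 0
    \<and> dual_value2 \<phi> F \<le> dual_value1 \<phi> F
    \<and> dual_value1 \<phi> F \<le> primal_value \<phi> F
    \<and> (int_nearly_convex_fun \<phi> \<longrightarrow> int_nearly_convex_map F
        \<longrightarrow> interior (epi \<phi>) \<inter> interior (gph F \<times> (UNIV :: real set)) \<noteq> {}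
        \<longrightarrow> dual_value1 \<phi> F = dual_value2 \<phi> F)"
proof (intro conjI impI)
  have dual_0: "xs 0 = 0" if "xs \<in> topdual" for xs :: "'a \<Rightarrow> real"
    using that linear_0 by (auto simp: topdual_def)
  show primal: "primal_value \<phi> F = optimal_value \<phi> F 0"
    by (simp add: primal_value_def optimal_value_def)
  show "dual_value1 \<phi> F = biconjugate (optimal_value \<phi> F) 0"
    unfolding dual_value1_def biconjugate_def
    by (rule SUP_cong) (simp_all add: dual_0 zero_ereal_def[symmetric])
  show weak: "dual_value2 \<phi> F \<le> dual_value1 \<phi> F"
    unfolding dual_value1_def dual_value2_def
    by (intro SUP_mono') (simp add: conjugate_optimal_value_le_infconv)
  show "dual_value1 \<phi> F \<le> primal_value \<phi> F"
    unfolding dual_value1_def primal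
  proof (rule SUP_least)
    fix xs :: "'a \<Rightarrow> real" assume "xs \<in> topdual"
    have "ereal (xs 0) - optimal_value \<phi> F 0 \<le> conjugate (optimal_value \<phi> F) xs"
      unfolding conjugate_def by (rule SUP_upper) simp
    then show "- conjugate (optimal_value \<phi> F) xs \<le> optimal_value \<phi> F 0"
      using dual_0[OF \<open>xs \<in> topdual\<close>]
      by (simp add: ereal_uminus_le_reorder flip: zero_ereal_def)
  qed
  assume "int_nearly_convex_fun \<phi>" "int_nearly_convex_map F"
    "interior (epi \<phi>) \<inter> interior (gph F \<times> (UNIV :: real set)) \<noteq> {}"
  then have "infconv_at_0 \<phi> F xs \<le> conjugate (optimal_value \<phi> F) xs" if "xs \<in> topdual" for xs
    using infconv_le_conjugate_optimal_value that by blast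
  then have "dual_value1 \<phi> F \<le> dual_value2 \<phi> F"
    unfolding dual_value1_def dual_value2_def by (intro SUP_mono) auto
  then show "dual_value1 \<phi> F = dual_value2 \<phi> F" using weak by (rule antisym)
qed

end
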